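(* Let $B\in\{1,\dots,9\}$, let $\tilde p\neq0$ be an integer and $\tilde q$ a positive integer with $\tilde q\geqslant 3600\sqrt[3]{|\tilde p|}$. Put $G_5=(\sqrt2-1)\tilde q^{2}+\frac{10-7\sqrt2}{B^{2}\tilde q^{2}}$. Then the equation $\tilde Q(t)=0$ has at least one purely imaginary root $t$ with $G_5+\frac{\tilde p}{2B^{3}\tilde q^{5}}<\operatorname{Im}t<G_5$ in the case $\tilde p<0$, respectively with $G_5<\operatorname{Im}t<G_5+\frac{\tilde p}{2B^{3}\tilde q^{5}}$ in the case $\tilde p>0$.
   Context: For numbers $p,q$ let $$Q_{pq}(t)=t^{10}+(2q^{2}+p^{2})(3q^{2}-2p^{2})\,t^{8}+(q^{8}+10p^{2}q^{6}+4p^{4}q^{4}-14p^{6}q^{2}+p^{8})\,t^{6}-p^{2}q^{2}(q^{8}-14p^{2}q^{6}+4p^{4}q^{4}+10p^{6}q^{2}+p^{8})\,t^{4}-p^{6}q^{6}(q^{2}+2p^{2})(3p^{2}-2q^{2})\,t^{2}-q^{10}p^{10}.$$ Given $B$, $\tilde p$, $\tilde q$, define $\tilde Q(t)=Q_{pq}(t)$ with $p=B\tilde q^{3}-\tilde p$ and $q=\tilde q$. *)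

theory Defs
  imports "HOL-Analysis.Analysis"
begin

definition Q :: "'a::comm_ring_1 \<Rightarrow> 'a \<Rightarrow> 'a \<Rightarrow> 'a" where
  "Q p q t =
     t^10
     + (2*q^2 + p^2) * (3*q^2 - 2*p^2) * t^8
     + (q^8 + 10*p^2*q^6 + 4*p^4*q^4 - 14*p^6*q^2 + p^8) * t^6
     - p^2*q^2 * (q^8 - 14*p^2*q^6 + 4*p^4*q^4 + 10*p^6*q^2 + p^8) * t^4
     - p^6*q^6 * (q^2 + 2*p^2) * (3*p^2 - 2*q^2) * t^2
     - q^10 * p^10"

definition Q_tilde :: "int \<Rightarrow> int \<Rightarrow> int \<Rightarrow> complex \<Rightarrow> complex" where
  "Q_tilde B pt qt t = Q (of_int (B * qt^3 - pt)) (of_int qt) t"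

definition G5 :: "int \<Rightarrow> int \<Rightarrow> real" where
  "G5 B qt = (sqrt 2 - 1) * (of_int qt)^2
             + (10 - 7 * sqrt 2) / ((of_int B)^2 * (of_int qt)^2)"

end

theory Submission
  imports Defs
begin

text \<open>
  The polynomial is homogeneous enough that \<open>t = \<i> q\<^sup>2 u\<close> turns it into
  \<open>p\<^sup>1\<^sup>0 q\<^sup>1\<^sup>0 f (q\<^sup>2/p\<^sup>2, u\<^sup>2)\<close>. With \<open>d = q\<^sup>2/p\<^sup>2\<close> small and
  \<open>u = \<surd>2 - 1 + d z\<close> one finds \<open>f = d (16 - 8\<surd>2) (z - (10 - 7\<surd>2)) + O(d\<^sup>2)\<close>, so the sign of \<open>f\<close>
  is that of \<open>z - (10 - 7\<surd>2)\<close> as soon as this difference exceeds a fixed multiple of \<open>d\<close>.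
  Put \<open>\<eta> = pt/q\<^sup>3\<close>, so that \<open>p = q\<^sup>3 (B - \<eta>)\<close>. At the two ends of the claimed interval the difference
  is about \<open>-0.2 \<eta>/B\<close> and \<open>0.3 \<eta>/B\<close>, while \<open>d\<close> is at most about
  \<open>\<bar>\<eta>\<bar>/(3600 B\<^sup>2)\<close>; the intermediate value theorem gives the root.
\<close>

definition Q_scaled :: "real \<Rightarrow> real \<Rightarrow> real" where
  "Q_scaled d y = - (d^5*y^5) + d^3*(2*d+1)*(3*d-2)*y^4 - d*(d^4+10*d^3+4*d^2-14*d+1)*y^3
     - (d^4-14*d^3+4*d^2+10*d+1)*y^2 + (d+2)*(3-2*d)*y - 1"

text \<open>Only even powers of t occur. With x = -t^2, r = q^2 and m = p^2, every term is
  homogeneous of degree 10 when x has weight 2 and r, m have weight 1. Dividing by m^5 r^5 therefore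
  leaves a function of r/m and x/r^2 alone.\<close>

lemma Q_imaginary_eq_Q_scaled:
  fixes p q u :: real
  assumes "p \<noteq> 0" "q \<noteq> 0"
  shows "Q (of_real p) (of_real q) (\<i> * of_real (q^2*u)) = of_real (p^10 * q^10 * Q_scaled (q^2/p^2) (u^2))"
proof -
  have i_powers: "\<i>^4 = 1" "\<i>^6 = -1" "\<i>^8 = 1" "\<i>^10 = -1"
    by (simp_all add: eval_nat_numeral)
  have even_powers: "(a^2)^2 = a^4" "(a^2)^3 = a^6" "(a^2)^4 = a^8" "(a^2)^5 = a^10" for a :: real
    by (simp_all flip: power_mult)
  have homogeneous: "- (x^5)
     + (2*r + m) * (3*r - 2*m) * x^4
     - (r^4 + 10*m*r^3 + 4*m^2*r^2 - 14*m^3*r + m^4) * x^3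
     - m*r * (r^4 - 14*m*r^3 + 4*m^2*r^2 + 10*m^3*r + m^4) * x^2
     + m^3*r^3 * (r + 2*m) * (3*m - 2*r) * x
     - r^5 * m^5 = m^5 * r^5 * Q_scaled d y"
    if "x = r^2 * y" "r = d * m" for x r m d y :: real
    unfolding that Q_scaled_def by algebra
  have "(q^2*u)^2 = (q^2)^2 * u^2" "q^2 = q^2/p^2 * p^2"
    using assms by (simp_all add: power_mult_distrib)
  note real_eq = homogeneous[OF this, unfolded even_powers]
  show ?thesis
    unfolding real_eq[symmetric] Q_def power_mult_distrib[of "\<i>"] i_powers power2_i
    by (simp only: of_real_add of_real_diff of_real_minus of_real_mult of_real_power of_real_numeral
        mult_1_left mult_minus_left mult_minus_right diff_minus_eq_add add_uminus_conv_diff)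
qed

lemma sqrt_2_bounds: "141421/100000 < sqrt 2" "sqrt 2 < 141422/100000"
  by (rule real_less_rsqrt real_less_lsqrt; simp add: power2_eq_square)+

text \<open>At d = 0 only -(y^2 - 6*y + 1) survives, and it vanishes at y = (sqrt 2 - 1)^2, so the
  expansion starts with the linear term in d. The remainder is bounded uniformly in z, and 60 is a
  generous round constant.\<close>

lemma Q_scaled_expansion:
  fixes d z :: real
  assumes d: "0 < d" "d \<le> 1/1000" and z: "\<bar>z\<bar> \<le> 1"
  shows "\<bar>Q_scaled d ((sqrt 2 - 1 + d*z)^2) - d * ((16 - 8 * sqrt 2) * (z - (10 - 7 * sqrt 2)))\<bar> \<le> 60 * d^2"
proof -
  define rt :: real where "rt = sqrt 2"
  have s2: "rt^2 = 2" by (simp add: rt_def)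
  have sb: "7/5 < rt" "rt < 71/50" using sqrt_2_bounds by (simp_all add: rt_def)
  define y0 where "y0 = 3 - 2*rt"
  define Y where "Y = 2*(rt-1)*z + d*z^2"
  define y where "y = y0 + d*Y"
  have y: "(rt - 1 + d*z)^2 = y"
    unfolding y_def y0_def Y_def by (algebra add: s2)
  have z2: "z^2 \<le> 1" using z by (simp add: abs_square_le_1)
  have "\<bar>2*(rt-1)*z\<bar> \<le> 21/25 * 1"
    unfolding abs_mult[of "2*(rt-1)"] by (rule mult_mono) (use sb z in auto)
  moreover have "\<bar>d*z^2\<bar> \<le> 1/1000 * 1"
    unfolding abs_mult by (rule mult_mono) (use d z2 in auto)
  ultimately have Y: "\<bar>Y\<bar> \<le> 1" unfolding Y_def by linarith
  have "\<bar>d*Y\<bar> \<le> 1/1000 * 1" unfolding abs_mult by (rule mult_mono) (use d Y in auto)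
  then have yb: "0 \<le> y" "y \<le> 1" and y0b: "0 \<le> y0" "y0 \<le> 1"
    using sb by (auto simp: y_def y0_def)
  have yp: "0 \<le> y^n" "y^n \<le> 1" for n using yb by (auto simp: power_le_one)
  have y0p: "0 \<le> y0^2" "y0^2 \<le> 1" using y0b by (auto simp: power_le_one)
  have yy0: "0 \<le> y*y0" "y*y0 \<le> 1" using yb y0b by (auto simp: mult_le_one)
  \<comment> \<open>\<open>g\<close> is the divided difference of y^3 + 10*y^2 + y between
    \<open>y\<close> and \<open>y0\<close>. \<open>E2\<close> to \<open>E5\<close> are the
    coefficients of d^2 to d^5 in \<open>Q_scaled d y\<close> with y held fixed.\<close>
  define g where "g = y^2 + y*y0 + y0^2 + 10*(y+y0) + 1"
  define E2 where "E2 = 14*y^3 - 4*y^2 - 2*y"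
  define E3 where "E3 = -2*y^4 - 4*y^3 + 14*y^2"
  define E4 where "E4 = - (y^4) - 10*y^3 - y^2"
  define E5 where "E5 = - (y^5) + 6*y^4 - y^3"
  define E where "E = - (Y^2) + 4*rt*z^2 - Y*g + E2 + d*E3 + d^2*E4 + d^3*E5"
  have in_d: "Q_scaled d y = - (y^2 - 6*y + 1) - d*(y^3 + 10*y^2 + y) + d^2*(E2 + d*E3 + d^2*E4 + d^3*E5)"
    unfolding E2_def E3_def E4_def E5_def Q_scaled_def by algebra
  have y0_root: "y0^2 - 6*y0 + 1 = 0"
    unfolding y0_def by (algebra add: s2)
  have quadratic: "y^2 - 6*y + 1 = - (4*rt*(d*Y)) + d^2*Y^2"
  proof -
    have "y^2 - 6*y + 1 = (y0^2 - 6*y0 + 1) + d*Y*(2*y0 - 6) + d^2*Y^2"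
      unfolding y_def by algebra
    also have "2*y0 - 6 = - (4*rt)" by (simp add: y0_def)
    finally show ?thesis by (simp add: y0_root)
  qed
  have "y^3 + 10*y^2 + y = y0^3 + 10*y0^2 + y0 + d*Y*g"
    unfolding g_def y_def by algebra
  \<comment> \<open>Reducing modulo the quadratic that \<open>y0\<close> satisfies leaves 16*y0^2.
    Its factor 10 - 7*rt is the value of z at which the linear term in d vanishes.\<close>
  also have "y0^3 + 10*y0^2 + y0 = 16*y0^2 + y0*(y0^2 - 6*y0 + 1)"
    by algebra
  also have "\<dots> = 16*y0^2" by (simp add: y0_root)
  also have "16*y0^2 = (16 - 8*rt) * (10 - 7*rt)"
    unfolding y0_def by (algebra add: s2)
  finally have cubic: "y^3 + 10*y^2 + y = (16 - 8*rt) * (10 - 7*rt) + d*Y*g" .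
  have linear: "4*rt*(d*Y) = d*((16 - 8*rt)*z) + d^2*(4*rt*z^2)"
    unfolding Y_def by (algebra add: s2)
  have main: "Q_scaled d y - d * ((16 - 8*rt) * (z - (10 - 7*rt))) = d^2 * E"
    unfolding in_d quadratic cubic linear E_def by (simp add: algebra_simps power2_eq_square)
  \<comment> \<open>As \<open>y\<close> lies in [0,1], each bound is the larger of the sums of the
    positive and of the negative coefficients.\<close>
  have E: "\<bar>E2\<bar> \<le> 14" "\<bar>E3\<bar> \<le> 14" "\<bar>E4\<bar> \<le> 12" "\<bar>E5\<bar> \<le> 6"
    using yp[of 2] yp[of 3] yp[of 4] yp[of 5] yb
    unfolding E2_def E3_def E4_def E5_def by linarith+
  have dp: "d^2 \<le> (1/1000)^2" "d^3 \<le> (1/1000)^3" using d by (intro power_mono; simp)+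
  have "\<bar>g\<bar> \<le> 24" using yp[of 2] y0p yy0 yb y0b by (simp add: g_def)
  then have "\<bar>Y*g\<bar> \<le> 1*24" unfolding abs_mult using Y by (intro mult_mono) auto
  moreover have "\<bar>Y^2\<bar> \<le> 1" using Y by (simp add: abs_square_le_1)
  moreover have "\<bar>4*rt*z^2\<bar> \<le> (4 * (71/50))*1" unfolding abs_mult[of "4*rt"]
    by (rule mult_mono) (use sb z2 in auto)
  moreover note E(1)
  moreover have "\<bar>d*E3\<bar> \<le> 1/1000 * 14" unfolding abs_mult
    by (rule mult_mono) (use d E in auto)
  moreover have "\<bar>d^2*E4\<bar> \<le> (1/1000)^2 * 12" unfolding abs_mult
    by (rule mult_mono) (use d dp E in auto)
  moreover have "\<bar>d^3*E5\<bar> \<le> (1/1000)^3 * 6" unfolding abs_mult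
    by (rule mult_mono) (use d dp E in auto)
  ultimately have "\<bar>E\<bar> \<le> 60"
    unfolding E_def abs_le_iff by (simp add: power_divide)
  then have "\<bar>d^2 * E\<bar> \<le> d^2 * 60" by (simp add: abs_mult mult_left_mono)
  with main y show ?thesis by (simp add: rt_def mult.commute)
qed

text \<open>The linear term has slope 16 - 8 * sqrt 2 > 4, so it beats the error 60 * d^2 once the
  distance from its zero exceeds 60 * d / 4 = 15 * d.\<close>

lemma Q_scaled_sign:
  fixes d z :: real
  assumes d: "0 < d" "d \<le> 1/1000" and z: "\<bar>z\<bar> \<le> 1"
    and far: "15 * d < \<bar>z - (10 - 7 * sqrt 2)\<bar>"
  shows "0 < Q_scaled d ((sqrt 2 - 1 + d*z)^2) * (z - (10 - 7 * sqrt 2))"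
proof -
  define k where "k = z - (10 - 7 * sqrt 2)"
  define f where "f = Q_scaled d ((sqrt 2 - 1 + d*z)^2)"
  have approx: "\<bar>f - d * ((16 - 8 * sqrt 2) * k)\<bar> \<le> 60 * d^2"
    using Q_scaled_expansion[OF d z] by (simp add: k_def f_def)
  have c: "4 < 16 - 8 * sqrt 2" using sqrt_2_bounds by simp
  have "60 * d^2 = d * (4 * (15 * d))" by (simp add: power2_eq_square)
  also have "\<dots> < d * ((16 - 8 * sqrt 2) * \<bar>k\<bar>)"
    by (intro mult_strict_left_mono mult_strict_mono) (use d c far in \<open>auto simp: k_def\<close>)
  finally have small: "60 * d^2 < d * ((16 - 8 * sqrt 2) * \<bar>k\<bar>)" .
  have "0 < f * k"
  proof (cases "k > 0")
    case True
    then have "f > 0" using approx small by (simp add: abs_le_iff)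
    with True show ?thesis by simp
  next
    case False
    then have "k < 0" using far d by (simp add: k_def)
    then have "f < 0" using approx small by (simp add: abs_le_iff)
    with \<open>k < 0\<close> show ?thesis by (simp add: mult_neg_neg)
  qed
  then show ?thesis by (simp add: f_def k_def)
qed

text \<open>Here \<open>w\<close> stands for p/q^3 and \<open>e\<close> for \<eta>; l = 0 and l =
  1/2 give the two ends of the interval. Both signs are measured against that of \<open>e\<close>,
  which treats negative and positive \<open>pt\<close> together.\<close>

lemma Q_scaled_opposite_signs:
  fixes B e w d :: real
  assumes B: "1 \<le> B" and e: "e \<noteq> 0" "\<bar>e\<bar> \<le> 1/1000"
    and w: "w = B - e" and d: "0 < d" "d * w^2 \<le> \<bar>e\<bar> / 3600"
  defines "v \<equiv> (\<lambda>l. (10 - 7 * sqrt 2) / B^2 + l * e / B^3)"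
  shows "Q_scaled d ((sqrt 2 - 1 + d * w^2 * v 0)^2) * e < 0"
    and "0 < Q_scaled d ((sqrt 2 - 1 + d * w^2 * v (1/2))^2) * e"
proof -
  define k where "k = 10 - 7 * sqrt 2"
  have k: "0.1 < k" "k < 0.101" using sqrt_2_bounds by (simp_all add: k_def)
  define r where "r = e / B"
  have r: "\<bar>r\<bar> \<le> 1/1000"
    using B e by (simp add: r_def abs_divide divide_le_eq)
  have r0: "r \<noteq> 0" using B e by (simp add: r_def)
  have er: "e = B * r" using B by (simp add: r_def)
  have wr: "w = B * (1 - r)" using B by (simp add: w er algebra_simps)
  define m where "m = (1-r)^2"
  have m: "0.99 \<le> m" "m \<le> 1.01"
  proof -
    have "0.999^2 \<le> m" unfolding m_def by (rule power_mono) (use r in auto)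
    then show "0.99 \<le> m" by (simp add: power2_eq_square)
    have "m \<le> 1.001^2" unfolding m_def by (rule power_mono) (use r in auto)
    then show "m \<le> 1.01" by (simp add: power2_eq_square)
  qed
  \<comment> \<open>In terms of r = e/B the powers of B cancel, so z depends only on r and
    l.\<close>
  have z: "w^2 * v l = m * (k + l * r)" for l
  proof -
    have "v l = (k + l * r) / B^2"
      using B unfolding v_def k_def er by (simp add: field_simps power2_eq_square power3_eq_cube)
    then show ?thesis using B by (simp add: wr m_def power_mult_distrib)
  qed
  have w2: "w^2 = B^2 * m" by (simp add: wr m_def power_mult_distrib)
  have "d * 0.99 * B \<le> d * m * B^2"
    using m d B by (intro mult_mono) (auto simp: power2_eq_square)
  also have "\<dots> \<le> \<bar>r\<bar> * B / 3600"
    using d B by (simp add: w2 er abs_mult mult_ac)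
  finally have dr: "d * 0.99 \<le> \<bar>r\<bar> / 3600"
    using B by (simp add: field_simps)
  have d_small: "d \<le> 1/1000" using dr r by simp
  \<comment> \<open>Both ends have z - k = c * r with c bounded away from 0, whereas 15 * d is only
    about 0.004 * \<bar>r\<bar>.\<close>
  have sign: "0 < Q_scaled d ((sqrt 2 - 1 + d * w^2 * v l)^2) * (c * e)"
    if diff: "m * (k + l * r) - k = c * r" and c: "0.1 \<le> \<bar>c\<bar>" and l: "0 \<le> l" "l \<le> 1" for l c
  proof -
    have "\<bar>l * r\<bar> \<le> 1 * (1/1000)" unfolding abs_mult using l r by (intro mult_mono) auto
    then have "\<bar>k + l * r\<bar> \<le> 0.2" using k by simp
    then have "\<bar>m * (k + l * r)\<bar> \<le> 1.01 * 0.2"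
      unfolding abs_mult using m by (intro mult_mono) auto
    then have z1: "\<bar>m * (k + l * r)\<bar> \<le> 1" by simp
    have "0.1 * \<bar>r\<bar> \<le> \<bar>c * r\<bar>" unfolding abs_mult using c by (intro mult_right_mono) auto
    moreover have "15 * d < 0.1 * \<bar>r\<bar>" using dr r0 by simp
    ultimately have far: "15 * d < \<bar>m * (k + l * r) - (10 - 7 * sqrt 2)\<bar>"
      unfolding diff[unfolded k_def] k_def by simp
    have "0 < Q_scaled d ((sqrt 2 - 1 + d * (m * (k + l * r)))^2) * (c * r)"
      using Q_scaled_sign[OF d(1) d_small z1 far] diff by (simp add: k_def)
    from mult_pos_pos[OF _ this, of B]
    have "0 < B * (Q_scaled d ((sqrt 2 - 1 + d * (m * (k + l * r)))^2) * (c * r))"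
      using B by simp
    then show ?thesis using z[of l] by (simp add: er mult_ac)
  qed
  have c0: "0.1 \<le> k * (2 - r)"
  proof -
    have "0.1 * 1 \<le> k * (2 - r)" using k r by (intro mult_mono) auto
    then show ?thesis by simp
  qed
  have "0 < Q_scaled d ((sqrt 2 - 1 + d * w^2 * v 0)^2) * (- (k * (2 - r)) * e)"
    using c0 by (intro sign) (auto simp: m_def power2_eq_square algebra_simps)
  then have "Q_scaled d ((sqrt 2 - 1 + d * w^2 * v 0)^2) * e * (k * (2 - r)) < 0"
    by (simp add: mult_ac)
  then show "Q_scaled d ((sqrt 2 - 1 + d * w^2 * v 0)^2) * e < 0"
    using c0 by (subst (asm) mult_less_0_iff) linarith
  \<comment> \<open>The shift by r/2 contributes m/2, at least 0.495, which outweighs k * (2 - r),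
    about 0.2, and so reverses the sign found at l = 0.\<close>
  have c1: "0.1 \<le> m/2 - k * (2 - r)"
  proof -
    have "k * (2 - r) \<le> 0.101 * 2.001" using k r by (intro mult_mono) auto
    then show ?thesis using m by simp
  qed
  have "0 < Q_scaled d ((sqrt 2 - 1 + d * w^2 * v (1/2))^2) * ((m/2 - k * (2 - r)) * e)"
  proof (rule sign)
    show "m * (k + 1/2 * r) - k = (m/2 - k * (2 - r)) * r"
      by (simp add: m_def power2_eq_square field_simps)
  qed (use c1 in auto)
  then have "0 < Q_scaled d ((sqrt 2 - 1 + d * w^2 * v (1/2))^2) * e * (m/2 - k * (2 - r))"
    by (simp add: mult_ac)
  then show "0 < Q_scaled d ((sqrt 2 - 1 + d * w^2 * v (1/2))^2) * e"
    using c1 by (subst (asm) zero_less_mult_iff) linarith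
qed

text \<open>The negative product covers crossings in both directions and keeps the root off the
  endpoints.\<close>

lemma sign_change_imp_root:
  fixes f :: "real \<Rightarrow> real"
  assumes "continuous_on UNIV f" "a < b" "f a * f b < 0"
  obtains x where "a < x" "x < b" "f x = 0"
proof -
  have cont: "continuous_on {a..b} f" using assms(1) continuous_on_subset by blast
  have "\<exists>x. a \<le> x \<and> x \<le> b \<and> f x = 0"
    using assms(2,3) IVT'[of f a 0 b, OF _ _ _ cont] IVT2'[of f b 0 a, OF _ _ _ cont]
    by (auto simp: mult_less_0_iff)
  then obtain x where x: "a \<le> x" "x \<le> b" "f x = 0" by blast
  moreover have "x \<noteq> a" "x \<noteq> b" using x assms(3) by auto
  ultimately show ?thesis using that by force
qed

theorem theorem5p2:
  fixes B pt qt :: int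
  assumes "B \<in> {1..9}"
    and "pt \<noteq> 0"
    and "qt > 0"
    and "real_of_int qt \<ge> 3600 * root 3 \<bar>real_of_int pt\<bar>"
  shows "(pt < 0 \<longrightarrow>
            (\<exists>t::complex. Q_tilde B pt qt t = 0 \<and> Re t = 0 \<and>
               G5 B qt + real_of_int pt / (2 * (real_of_int B)^3 * (real_of_int qt)^5) < Im t \<and>
               Im t < G5 B qt)) \<and>
         (pt > 0 \<longrightarrow>
            (\<exists>t::complex. Q_tilde B pt qt t = 0 \<and> Re t = 0 \<and>
               G5 B qt < Im t \<and>
               Im t < G5 B qt + real_of_int pt / (2 * (real_of_int B)^3 * (real_of_int qt)^5)))"
proof -
  define b where "b = real_of_int B"
  define a where "a = real_of_int pt"
  define q where "q = real_of_int qt"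
  have b: "1 \<le> b" using assms(1) by (auto simp: b_def)
  have q0: "q > 0" using assms(3) by (simp add: q_def)
  have a1: "1 \<le> \<bar>a\<bar>" using assms(2) by (simp add: a_def flip: of_int_abs)
  have root: "3600 * root 3 \<bar>a\<bar> \<le> q" using assms(4) by (simp add: a_def q_def)
  have "1 \<le> root 3 \<bar>a\<bar>" using a1 by simp
  then have q: "3600 \<le> q" using root by linarith
  have "(3600 * root 3 \<bar>a\<bar>)^3 \<le> q^3" using root by (intro power_mono) auto
  then have q3: "3600^3 * \<bar>a\<bar> \<le> q^3" by (simp add: power_mult_distrib)
  define e where "e = a / q^3"
  define w where "w = b - e"
  define p where "p = b * q^3 - a"
  define d where "d = q^2 / p^2"
  have e0: "e \<noteq> 0" using a1 q0 by (auto simp: e_def)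
  have e_small: "\<bar>e\<bar> \<le> 1/1000"
    using q3 q0 by (simp add: e_def abs_divide divide_le_eq)
  have w0: "w > 0" using b e_small by (simp add: w_def)
  have p: "p = q^3 * w" using q0 by (simp add: p_def w_def e_def field_simps)
  have p0: "p \<noteq> 0" using p w0 q0 by simp
  have d0: "d > 0" using p0 q0 by (simp add: d_def)
  have dw: "d * w^2 = 1 / q^4"
    using w0 q0 by (simp add: d_def p power_mult_distrib field_simps flip: power_mult power_add)
  \<comment> \<open>Since 1/q^4 = (1/q) * (1/q^3) and \<bar>e\<bar> = \<bar>a\<bar>/q^3, the bound
    needed on d * w^2 amounts to 3600 \<le> q * \<bar>a\<bar>.\<close>
  have "3600 * 1 \<le> q * \<bar>a\<bar>" using q a1 by (intro mult_mono) auto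
  then have "1 / q^4 \<le> \<bar>e\<bar> / 3600"
    using q0 by (simp add: e_def abs_divide field_simps eval_nat_numeral)
  then have dw_le: "d * w^2 \<le> \<bar>e\<bar> / 3600"
    by (simp add: dw)
  define f where "f = (\<lambda>x. Q_scaled d ((x / q^2)^2))"
  have cont: "continuous_on UNIV f"
    unfolding f_def Q_scaled_def by (intro continuous_intros) (use q0 in auto)
  have zero: "Q_tilde B pt qt (\<i> * of_real x) = 0" if "f x = 0" for x
  proof -
    have "complex_of_int (B * qt^3 - pt) = of_real p" "complex_of_int qt = of_real q"
      by (simp_all add: p_def b_def a_def q_def)
    moreover have "x = q^2 * (x / q^2)" using q0 by simp
    ultimately show ?thesis
      using Q_imaginary_eq_Q_scaled[OF p0, of q "x / q^2"] that q0
      by (simp add: Q_tilde_def f_def d_def)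
  qed
  define G where "G = G5 B qt"
  define H where "H = G + a / (2 * b^3 * q^5)"
  \<comment> \<open>Division by q^2 turns the corrections of order 1/q^2 and 1/q^5 into multiples of
    1/q^4 = d * w^2; l = 0 gives \<open>G\<close> and l = 1/2 gives \<open>H\<close>.\<close>
  have endpoint: "(G + l * a / (b^3 * q^5)) / q^2
      = sqrt 2 - 1 + d * w^2 * ((10 - 7 * sqrt 2) / b^2 + l * e / b^3)" for l
    using q0 b unfolding dw G_def G5_def e_def b_def[symmetric] q_def[symmetric]
    by (simp add: add_divide_distrib distrib_left eval_nat_numeral mult_ac)
  note signs = Q_scaled_opposite_signs[OF b e0 e_small w_def d0 dw_le]
  have fG: "f G * e < 0" using signs(1) endpoint[of 0] by (simp add: f_def)
  have fH: "0 < f H * e" using signs(2) endpoint[of "1/2"] by (simp add: f_def H_def mult_ac)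
  have opposite: "f G * f H < 0"
    using fG fH by (auto simp: mult_less_0_iff zero_less_mult_iff)
  have "\<exists>t. Q_tilde B pt qt t = 0 \<and> Re t = 0 \<and> H < Im t \<and> Im t < G" if "pt < 0"
  proof -
    have "H < G" using that b q0 by (simp add: H_def a_def divide_neg_pos)
    then obtain x where "H < x" "x < G" "f x = 0"
      using sign_change_imp_root[OF cont, of H G] opposite by (auto simp: mult.commute)
    then show ?thesis using zero by (intro exI[of _ "\<i> * of_real x"]) auto
  qed
  moreover have "\<exists>t. Q_tilde B pt qt t = 0 \<and> Re t = 0 \<and> G < Im t \<and> Im t < H" if "pt > 0"
  proof -
    have "G < H" using that b q0 by (simp add: H_def a_def)
    then obtain x where "G < x" "x < H" "f x = 0"
      using sign_change_imp_root[OF cont, of G H] opposite by auto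
    then show ?thesis using zero by (intro exI[of _ "\<i> * of_real x"]) auto
  qed
  ultimately show ?thesis by (simp add: H_def G_def a_def b_def q_def)
qed

end
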